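(* If $\varphi\in\Phi$, $K,L\in\mathcal{S}_o^n$ and $k_1,k_2>0$, then $$\tilde{\widehat{V}}_{\varphi}(K,L)\ \geq\ \left(\frac{k_2}{k_1}\,\frac{V(L)}{V(K)}\right)^{1/n}.$$ If $\varphi$ is strictly convex and $V(L)>0$, then equality holds if and only if $K$ and $L$ are dilates.
   Context: $\mathcal{S}_o^n$ is the set of star bodies in $\mathbb{R}^n$: compact sets $K\subset\mathbb{R}^n$, star-shaped with respect to the origin, whose radial function $\rho(K,u)=\max\{\lambda\ge 0:\lambda u\in K\}$, $u\in S^{n-1}$, is positive and continuous on $S^{n-1}$. $V$ denotes $n$-dimensional volume and $S$ denotes the spherical Lebesgue (surface area) measure on $S^{n-1}$. $K$ and $L$ are dilates if $L=cK$ for some $c>0$. $\Phi$ is the set of convex functions $\varphi:[0,\infty)\to[0,\infty)$ that are strictly increasing and satisfy $\varphi(0)=0$ and $\varphi(1)=1$. For $K,L\in\mathcal{S}_o^n$, $\varphi\in\Phi$ and $k_1,k_2>0$, define the real number (called the Orlicz dual projection body) $$\tilde{\widehat{V}}_{\varphi}(K,L)=\inf\left\{\lambda>0:\ \frac{1}{nV(K)}\int_{S^{n-1}}\varphi\!\left(\frac{k_2\,\rho(L,u)^n}{k_1\,\lambda^n\rho(K,u)^n}\right)\rho(K,u)^n\,dS(u)\leq1\right\}.$$ *)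

theory Defs imports "HOL-Analysis.Analysis" begin

abbreviation vol :: "(real ^ 'n) set \<Rightarrow> real" where
  "vol K \<equiv> measure lborel K"

text \<open>
  Spherical Lebesgue measure on the unit sphere, by the usual cone construction
  \<open>S(A) = n \<cdot> V({r u | 0 < r \<le> 1, u \<in> A})\<close>: the push-forward of Lebesgue measure on the
  punctured unit ball under \<open>x \<mapsto> x / \<parallel>x\<parallel>\<close>, scaled by the dimension. For \<open>n = 1\<close> it is the
  counting measure on the two-point sphere.
\<close>

definition sphere_measure :: "(real ^ 'n) measure" where
  "sphere_measure =
     scale_measure (of_nat CARD('n))
       (distr (restrict_space lborel (cball 0 1 - {0})) (restrict_space borel (sphere 0 1)) sgn)"

lemma emeasure_sphere_measure:
  fixes A :: "(real ^ 'n) set"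
  assumes "A \<in> sets borel" "A \<subseteq> sphere 0 1"
  shows "emeasure sphere_measure A =
     of_nat CARD('n) * emeasure lborel {r *\<^sub>R u | r u. 0 < r \<and> r \<le> 1 \<and> u \<in> A}"
proof -
  let ?B = "cball 0 1 - {0} :: (real ^ 'n) set"
  let ?R = "restrict_space lborel ?B"
  have "(sgn :: real ^ 'n \<Rightarrow> _) \<in> borel_measurable borel"
    unfolding sgn_div_norm by measurable
  then have "(sgn :: real ^ 'n \<Rightarrow> _) \<in> borel_measurable ?R"
    by (intro measurable_restrict_space1) simp
  moreover have "sgn \<in> space ?R \<rightarrow> sphere 0 1"
    by (auto simp: space_restrict_space norm_sgn)
  ultimately have meas: "sgn \<in> measurable ?R (restrict_space borel (sphere 0 1))"
    by (simp add: measurable_restrict_space2_iff)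
  have A: "A \<in> sets (restrict_space borel (sphere 0 1))"
    using assms by (auto simp: sets_restrict_space_iff)
  have eq: "sgn -` A \<inter> space ?R = {r *\<^sub>R u | r u. 0 < r \<and> r \<le> 1 \<and> u \<in> A}"
  proof (intro equalityI subsetI)
    fix x assume "x \<in> sgn -` A \<inter> space ?R"
    then have "x = norm x *\<^sub>R sgn x" "0 < norm x" "norm x \<le> 1" "sgn x \<in> A"
      by (auto simp: space_restrict_space sgn_div_norm)
    then show "x \<in> {r *\<^sub>R u | r u. 0 < r \<and> r \<le> 1 \<and> u \<in> A}" by blast
  next
    fix x assume "x \<in> {r *\<^sub>R u | r u. 0 < r \<and> r \<le> 1 \<and> u \<in> A}"
    then obtain r u where x: "x = r *\<^sub>R u" "0 < r" "r \<le> 1" "u \<in> A" by blast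
    then have "norm u = 1" using assms(2) by auto
    with x show "x \<in> sgn -` A \<inter> space ?R"
      by (auto simp: space_restrict_space sgn_div_norm)
  qed
  have "emeasure sphere_measure A = of_nat CARD('n) * emeasure ?R (sgn -` A \<inter> space ?R)"
    unfolding sphere_measure_def by (simp add: emeasure_distr[OF meas A])
  also have "emeasure ?R (sgn -` A \<inter> space ?R) = emeasure lborel (sgn -` A \<inter> space ?R)"
    by (rule emeasure_restrict_space) (auto simp: space_restrict_space)
  finally show ?thesis unfolding eq .
qed

definition radial :: "(real ^ 'n) set \<Rightarrow> real ^ 'n \<Rightarrow> real" where
  "radial K u = (GREATEST l. 0 \<le> l \<and> l *\<^sub>R u \<in> K)"

text \<open>
  Star-shapedness includes \<open>0 \<in> K\<close>. Together with compactness this makes the maximum in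
  \<^const>\<open>radial\<close> exist for every unit vector \<open>u\<close>.
\<close>

definition star_body :: "(real ^ 'n) set \<Rightarrow> bool" where
  "star_body K \<longleftrightarrow>
     compact K \<and> 0 \<in> K \<and> (\<forall>x\<in>K. closed_segment 0 x \<subseteq> K) \<and>
     (\<forall>u\<in>sphere 0 1. 0 < radial K u) \<and> continuous_on (sphere 0 1) (radial K)"

definition dilates :: "(real ^ 'n) set \<Rightarrow> (real ^ 'n) set \<Rightarrow> bool" where
  "dilates K L \<longleftrightarrow> (\<exists>c>0. L = (\<lambda>x. c *\<^sub>R x) ` K)"

text \<open>Only the values of \<open>\<phi>\<close> on \<open>[0,\<infinity>)\<close> matter.\<close>

definition Orlicz_functions :: "(real \<Rightarrow> real) set"  (\<open>\<Phi>\<close>) where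
  "\<Phi> = {\<phi>. \<phi> ` {0..} \<subseteq> {0..} \<and> convex_on {0..} \<phi> \<and> strict_mono_on {0..} \<phi> \<and> \<phi> 0 = 0 \<and> \<phi> 1 = 1}"

definition strictly_convex_on :: "real set \<Rightarrow> (real \<Rightarrow> real) \<Rightarrow> bool" where
  "strictly_convex_on S f \<longleftrightarrow> convex S \<and>
     (\<forall>x\<in>S. \<forall>y\<in>S. \<forall>t. x \<noteq> y \<longrightarrow> 0 < t \<longrightarrow> t < 1 \<longrightarrow>
        f ((1 - t) * x + t * y) < (1 - t) * f x + t * f y)"

definition Orlicz_dual ::
  "real \<Rightarrow> real \<Rightarrow> (real \<Rightarrow> real) \<Rightarrow> (real ^ 'n) set \<Rightarrow> (real ^ 'n) set \<Rightarrow> real" where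
  "Orlicz_dual k1 k2 \<phi> K L =
     Inf {l. 0 < l \<and>
       1 / (real CARD('n) * vol K) *
       (LINT u|sphere_measure.
          \<phi> (k2 * radial L u ^ CARD('n) / (k1 * l ^ CARD('n) * radial K u ^ CARD('n)))
            * radial K u ^ CARD('n)) \<le> 1}"

end

theory Submission imports Defs begin

text \<open>
  With \<open>a = k\<^sub>2 / k\<^sub>1\<close> and \<open>h\<^sub>l = a \<rho>\<^sub>L\<^sup>n / (l\<^sup>n \<rho>\<^sub>K\<^sup>n)\<close>, polar coordinates
  say that \<open>\<rho>\<^sub>K\<^sup>n dS / (n V(K))\<close> is a probability measure for which \<open>h\<^sub>l\<close> has mean
  \<open>m = a V(L) / (l\<^sup>n V(K))\<close>. Jensen's inequality turns the constraint on \<open>l\<close> into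
  \<open>\<phi>(m) \<le> 1 = \<phi>(1)\<close>, that is \<open>m \<le> 1\<close>, which is the lower bound. The infimum is attained,
  by dominated convergence; if it equals the bound, then \<open>m = 1\<close> there, and strict convexity
  forces the continuous function \<open>h\<^sub>l\<close> to be identically \<open>1\<close>.
\<close>

subsection \<open>Polar coordinates\<close>

lemma space_sphere_measure: "space (sphere_measure :: (real^'n) measure) = sphere 0 1"
  by (simp add: sphere_measure_def space_scale_measure)

lemma sets_sphere_measure:
  "sets (sphere_measure :: (real^'n) measure) = sets (restrict_space borel (sphere 0 1))"
  by (simp add: sphere_measure_def)

lemma measurable_sgn: "(sgn :: real^'n \<Rightarrow> _) \<in> borel_measurable borel"
  unfolding sgn_div_norm by measurable

lemma norm_sgn_nonzero: "x \<noteq> 0 \<Longrightarrow> norm (sgn (x::'a::real_normed_vector)) = 1"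
  by (simp add: norm_sgn)

lemma norm_scaleR_sgn: "norm x *\<^sub>R sgn x = (x::'a::real_normed_vector)"
  by (cases "x = 0") (auto simp: sgn_div_norm)

lemma sets_sphere_measure_iff:
  "A \<in> sets (sphere_measure :: (real^'n) measure) \<longleftrightarrow> A \<in> sets borel \<and> A \<subseteq> sphere 0 1"
proof -
  have "sphere 0 1 \<inter> space (borel :: (real^'n) measure) \<in> sets borel" by simp
  then show ?thesis by (subst sets_sphere_measure) (auto simp: sets_restrict_space_iff)
qed

text \<open>The set is the image of the open unit cone over \<open>A\<close> under dilation by the
  \<open>n\<close>-th root of \<open>r\<close>, where \<open>n\<close> is the dimension, and
  dilation by \<open>s\<close> multiplies volume by \<open>s ^ n\<close>.\<close>

lemma emeasure_cone:
  fixes A :: "(real^'n) set"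
  assumes A: "A \<in> sets sphere_measure" and r: "0 \<le> r"
  shows "{x. x \<noteq> 0 \<and> norm x ^ CARD('n) < r \<and> sgn x \<in> A} \<in> sets lborel" (is "?C \<in> _")
    and "of_nat CARD('n) * emeasure lborel {x. x \<noteq> 0 \<and> norm x ^ CARD('n) < r \<and> sgn x \<in> A}
       = ennreal r * emeasure sphere_measure A"
proof -
  note [measurable] = measurable_sgn
  from A have A': "A \<in> sets borel" "A \<subseteq> sphere 0 1" by (auto simp: sets_sphere_measure_iff)
  note [measurable] = A'(1)
  show "?C \<in> sets lborel" by measurable
  show "of_nat CARD('n) * emeasure lborel ?C = ennreal r * emeasure sphere_measure A"
  proof (cases "r = 0")
    case True
    then have "?C = {}" by (auto simp: not_less)
    then show ?thesis using True by simp
  next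
    case False
    with r have r: "r > 0" by simp
    define s where "s = root CARD('n) r"
    have s: "s > 0" "s ^ CARD('n) = r" using r by (auto simp: s_def)
    have less_s: "norm x ^ CARD('n) < r \<longleftrightarrow> norm x < s" for x :: "real^'n"
      using s power_less_imp_less_base[of "norm x" "CARD('n)" s]
        power_strict_mono[of "norm x" s "CARD('n)"] by auto
    let ?U = "{x. x \<noteq> 0 \<and> norm x < 1 \<and> sgn x \<in> A}"
    let ?V = "{r *\<^sub>R u | r u. 0 < r \<and> r \<le> 1 \<and> u \<in> A}"
    \<comment> \<open>The summand \<open>0\<close> gives the dilation the affine shape that
      \<open>emeasure_lebesgue_affine\<close> expects.\<close>
    have C: "?C = (\<lambda>x. s *\<^sub>R x + 0) ` ?U"
    proof (intro equalityI subsetI)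
      fix x assume "x \<in> ?C"
      with s have "x = s *\<^sub>R ((1/s) *\<^sub>R x) + 0" "(1/s) *\<^sub>R x \<in> ?U"
        by (auto simp: less_s sgn_scaleR divide_simps)
      then show "x \<in> (\<lambda>x. s *\<^sub>R x + 0) ` ?U" by blast
    qed (use s in \<open>auto simp: less_s sgn_scaleR\<close>)
    have V: "?V = {x. x \<noteq> 0 \<and> norm x \<le> 1 \<and> sgn x \<in> A}"
    proof (intro equalityI subsetI)
      fix x assume "x \<in> {x. x \<noteq> 0 \<and> norm x \<le> 1 \<and> sgn x \<in> A}"
      then have "x = norm x *\<^sub>R sgn x" "0 < norm x" "norm x \<le> 1" "sgn x \<in> A"
        by (auto simp: norm_scaleR_sgn)
      then show "x \<in> ?V" by blast
    next
      fix x assume "x \<in> ?V"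
      then obtain r u where x: "x = r *\<^sub>R u" "0 < r" "r \<le> 1" "u \<in> A" by blast
      then have "norm u = 1" using A' by auto
      with x show "x \<in> {x. x \<noteq> 0 \<and> norm x \<le> 1 \<and> sgn x \<in> A}"
        by (auto simp: sgn_scaleR sgn_div_norm)
    qed
    have Vm: "?V \<in> sets lborel" unfolding V by measurable
    have Um: "?U \<in> sets lborel" by measurable
    \<comment> \<open>\<open>?U\<close> and \<open>?V\<close> differ only in points of the unit
      sphere, which is null.\<close>
    have "(sphere 0 1 :: (real^'n) set) \<in> null_sets lborel"
      using negligible_sphere[of "0::real^'n" 1]
      by (auto simp: null_sets_completion_iff negligible_iff_null_sets)
    then have "AE x in lborel. (x::real^'n) \<notin> sphere 0 1" by (rule AE_not_in)
    then have "emeasure lborel ?U = emeasure lborel ?V"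
      by (intro emeasure_eq_AE[OF _ Um Vm]) (auto simp: V elim!: eventually_mono)
    moreover have "emeasure lborel ?C = ennreal (s ^ CARD('n)) * emeasure lborel ?U"
    proof -
      have "emeasure lebesgue ?C = ennreal (s ^ CARD('n)) * emeasure lebesgue ?U"
        unfolding C by (subst emeasure_lebesgue_affine) (use s in \<open>simp add: ennreal_power\<close>)
      moreover have "?C \<in> sets lborel" by measurable
      ultimately show ?thesis using Um by simp
    qed
    ultimately show ?thesis
      using s emeasure_sphere_measure[OF A'] by (simp add: mult_ac)
  qed
qed

text \<open>Bounding \<open>|x|\<^sup>n\<close> rather than \<open>|x|\<close> makes the measure of the region linear in \<open>g\<close>.\<close>

lemma emeasure_radial_sublevel_simple:
  fixes g :: "real^'n \<Rightarrow> ennreal"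
  assumes g: "simple_function sphere_measure g" and fin: "\<And>u. g u < top"
  shows "{x. x \<noteq> 0 \<and> ennreal (norm x ^ CARD('n)) < g (sgn x)} \<in> sets lborel" (is "?E \<in> _")
    and "of_nat CARD('n) * emeasure lborel {x. x \<noteq> 0 \<and> ennreal (norm x ^ CARD('n)) < g (sgn x)}
       = (\<integral>\<^sup>+u. g u \<partial>sphere_measure)"
proof -
  let ?S = "sphere_measure :: (real^'n) measure"
  let ?A = "\<lambda>y. {u\<in>space ?S. g u = y}"
  let ?C = "\<lambda>y. {x. x \<noteq> 0 \<and> norm x ^ CARD('n) < enn2real y \<and> sgn x \<in> ?A y}"
  have A: "?A y \<in> sets ?S" for y
    using simple_functionD(2)[OF g, of "{y}"] by (simp add: vimage_def Int_def conj_commute)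
  have fin_range: "finite (g ` space ?S)" using simple_functionD(1)[OF g] .
  \<comment> \<open>Over a level set of \<open>g\<close> the height is constant, so
    \<open>?E\<close> is a finite disjoint union of regions measured by
    \<open>emeasure_cone\<close>.\<close>
  have E: "?E = (\<Union>y\<in>g ` space ?S. ?C y)"
  proof -
    have "ennreal t < g u \<longleftrightarrow> t < enn2real (g u)" if "0 \<le> t" for t u
      using fin[of u] that
      by (cases "g u") (auto simp: ennreal_less_iff)
    then have "?E = {x. x \<noteq> 0 \<and> norm x ^ CARD('n) < enn2real (g (sgn x))}" by simp
    also have "\<dots> = (\<Union>y\<in>g ` space ?S. ?C y)"
    proof (intro equalityI subsetI)
      fix x assume x: "x \<in> {x. x \<noteq> 0 \<and> norm x ^ CARD('n) < enn2real (g (sgn x))}"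
      then have "sgn x \<in> space ?S" by (simp add: space_sphere_measure norm_sgn_nonzero)
      with x show "x \<in> (\<Union>y\<in>g ` space ?S. ?C y)"
        by (intro UN_I[of "g (sgn x)"]) auto
    qed auto
    finally show ?thesis .
  qed
  have C: "?C y \<in> sets lborel" for y
    by (rule emeasure_cone(1)[OF A]) simp
  show "?E \<in> sets lborel" unfolding E using fin_range C by blast
  have "of_nat CARD('n) * emeasure lborel ?E
      = of_nat CARD('n) * (\<Sum>y\<in>g ` space ?S. emeasure lborel (?C y))"
  proof -
    have "?C y \<inter> ?C z = {}" if "y \<noteq> z" for y z using that by blast
    then have "disjoint_family_on ?C (g ` space ?S)" by (simp add: disjoint_family_on_def)
    moreover have "?C ` g ` space ?S \<subseteq> sets lborel" using C by blast
    ultimately have "(\<Sum>y\<in>g ` space ?S. emeasure lborel (?C y)) = emeasure lborel (\<Union>y\<in>g ` space ?S. ?C y)"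
      using fin_range by (intro sum_emeasure)
    then show ?thesis by (simp only: E)
  qed
  also have "\<dots> = (\<Sum>y\<in>g ` space ?S. y * emeasure ?S (?A y))"
    unfolding sum_distrib_left
  proof (rule sum.cong[OF refl])
    fix y assume "y \<in> g ` space ?S"
    then have "ennreal (enn2real y) = y" using fin by auto
    then show "of_nat CARD('n) * emeasure lborel (?C y) = y * emeasure ?S (?A y)"
      using emeasure_cone(2)[OF A, of "enn2real y" y] by simp
  qed
  also have "\<dots> = integral\<^sup>S ?S g"
    by (simp add: simple_integral_def vimage_def Int_def conj_commute)
  also have "\<dots> = (\<integral>\<^sup>+u. g u \<partial>?S)"
    by (rule nn_integral_eq_simple_integral[OF g, symmetric])
  finally show "of_nat CARD('n) * emeasure lborel ?E = (\<integral>\<^sup>+u. g u \<partial>?S)" .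
qed

text \<open>Monotone convergence from the simple case, on the side of the regions and on the side of
  the integrals.\<close>

lemma emeasure_radial_sublevel:
  fixes g :: "real^'n \<Rightarrow> ennreal"
  assumes g: "g \<in> borel_measurable sphere_measure"
  shows "{x. x \<noteq> 0 \<and> ennreal (norm x ^ CARD('n)) < g (sgn x)} \<in> sets lborel" (is "?E \<in> _")
    and "of_nat CARD('n) * emeasure lborel {x. x \<noteq> 0 \<and> ennreal (norm x ^ CARD('n)) < g (sgn x)}
       = (\<integral>\<^sup>+u. g u \<partial>sphere_measure)"
proof -
  obtain f where f: "\<And>i. simple_function sphere_measure (f i)" "incseq f"
      "\<And>i x. f i x < top" "\<And>x. (SUP i. f i x) = g x"
    using borel_measurable_implies_simple_function_sequence'[OF g] by metis
  let ?F = "\<lambda>i. {x. x \<noteq> 0 \<and> ennreal (norm x ^ CARD('n)) < f i (sgn x)}"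
  \<comment> \<open>The inequality is strict, so a number below the supremum is already below some
    \<open>f i\<close>; with \<open>\<le>\<close> the regions \<open>?F i\<close> need not exhaust
    \<open>?E\<close>.\<close>
  have E: "?E = (\<Union>i. ?F i)"
    by (auto simp: f(4)[symmetric] less_SUP_iff)
  have F: "?F i \<in> sets lborel" for i by (rule emeasure_radial_sublevel_simple(1)[OF f(1,3)])
  show "?E \<in> sets lborel" unfolding E using F by blast
  have inc: "incseq ?F"
    using f(2) by (auto simp: incseq_def le_fun_def intro: less_le_trans)
  have "of_nat CARD('n) * emeasure lborel ?E = of_nat CARD('n) * (SUP i. emeasure lborel (?F i))"
    unfolding E using F inc by (subst SUP_emeasure_incseq) auto
  also have "\<dots> = (SUP i. of_nat CARD('n) * emeasure lborel (?F i))"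
    by (rule SUP_mult_left_ennreal)
  also have "\<dots> = (SUP i. \<integral>\<^sup>+u. f i u \<partial>sphere_measure)"
    by (simp only: emeasure_radial_sublevel_simple(2)[OF f(1,3)])
  also have "\<dots> = (\<integral>\<^sup>+u. (SUP i. f i u) \<partial>sphere_measure)"
    using f(1,2) by (intro nn_integral_monotone_convergence_SUP[symmetric])
      (auto intro: borel_measurable_simple_function)
  finally show "of_nat CARD('n) * emeasure lborel ?E = (\<integral>\<^sup>+u. g u \<partial>sphere_measure)"
    by (simp only: f(4))
qed

section \<open>Continuous functions on the sphere\<close>

text \<open>The total mass is \<open>n\<close> times the volume of the punctured open unit ball, the
  cone over the whole sphere.\<close>

lemma finite_sphere_measure: "finite_measure (sphere_measure :: (real^'n) measure)"
proof
  let ?B = "{x::real^'n. x \<noteq> 0 \<and> norm x ^ CARD('n) < 1 \<and> sgn x \<in> sphere 0 1}"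
  have "?B \<subseteq> cball 0 1" 
  proof
    fix x assume "x \<in> ?B"
    then have "norm x < 1" by (simp, meson not_le one_le_power)
    then show "x \<in> cball 0 1" by simp
  qed
  then have "emeasure lborel ?B \<le> emeasure lborel (cball (0::real^'n) 1)"
    by (rule emeasure_mono) simp
  also have "\<dots> < \<infinity>" by (rule emeasure_lborel_cball_finite)
  finally have *: "emeasure lborel ?B < \<infinity>" .
  have "emeasure (sphere_measure :: (real^'n) measure) (sphere 0 1) = of_nat CARD('n) * emeasure lborel ?B"
    by (subst emeasure_cone(2)) (auto simp: sets_sphere_measure_iff)
  also have "\<dots> < \<infinity>" using * by (simp add: ennreal_mult_less_top of_nat_less_top)
  finally show "emeasure (sphere_measure :: (real^'n) measure) (space sphere_measure) \<noteq> \<infinity>"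
    by (simp add: space_sphere_measure)
qed

lemma measurable_sphere_continuous:
  fixes g :: "real^'n \<Rightarrow> real"
  assumes "continuous_on (sphere 0 1) g"
  shows "g \<in> borel_measurable sphere_measure"
  using borel_measurable_continuous_on_restrict[OF assms]
  by (simp add: measurable_def space_sphere_measure sets_sphere_measure space_restrict_space)

lemma integrable_sphere_continuous:
  fixes g :: "real^'n \<Rightarrow> real"
  assumes "continuous_on (sphere 0 1) g"
  shows "integrable sphere_measure g"
proof -
  have "bounded (g ` sphere 0 1)"
    using assms by (intro compact_imp_bounded compact_continuous_image) auto
  then obtain B where "\<And>u. u \<in> sphere 0 1 \<Longrightarrow> norm (g u) \<le> B"
    unfolding bounded_iff by blast
  then show ?thesis
    by (intro finite_measure.integrable_const_bound[OF finite_sphere_measure, of _ B]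
        measurable_sphere_continuous assms AE_I2) (auto simp: space_sphere_measure)
qed

lemma emeasure_radial_sublevel_continuous:
  fixes g :: "real^'n \<Rightarrow> real"
  assumes g: "continuous_on (sphere 0 1) g" and nonneg: "\<And>u. u \<in> sphere 0 1 \<Longrightarrow> 0 \<le> g u"
  shows "{x. x \<noteq> 0 \<and> norm x ^ CARD('n) < g (sgn x)} \<in> sets lborel"
    and "of_nat CARD('n) * emeasure lborel {x. x \<noteq> 0 \<and> norm x ^ CARD('n) < g (sgn x)}
       = ennreal (LINT u|sphere_measure. g u)"
proof -
  have "{x. x \<noteq> 0 \<and> norm x ^ CARD('n) < g (sgn x)}
      = {x. x \<noteq> 0 \<and> ennreal (norm x ^ CARD('n)) < ennreal (g (sgn x))}"
    by (auto simp: ennreal_less_iff)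
  moreover have m: "(\<lambda>u. ennreal (g u)) \<in> borel_measurable sphere_measure"
    using measurable_sphere_continuous[OF g] by measurable
  moreover have "(\<integral>\<^sup>+u. ennreal (g u) \<partial>sphere_measure) = ennreal (LINT u|sphere_measure. g u)"
    by (intro nn_integral_eq_integral integrable_sphere_continuous g AE_I2 nonneg)
      (simp add: space_sphere_measure)
  ultimately show "{x. x \<noteq> 0 \<and> norm x ^ CARD('n) < g (sgn x)} \<in> sets lborel"
    and "of_nat CARD('n) * emeasure lborel {x. x \<noteq> 0 \<and> norm x ^ CARD('n) < g (sgn x)}
       = ennreal (LINT u|sphere_measure. g u)"
    using emeasure_radial_sublevel[OF m] by simp_all
qed

text \<open>If \<open>g u\<close> were positive, the region below the graph of \<open>g\<close> in
  polar coordinates would be open and nonempty, hence of positive volume; but its volume is the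
  integral divided by \<open>n\<close>.\<close>

lemma sphere_integral_0_imp:
  fixes g :: "real^'n \<Rightarrow> real"
  assumes g: "continuous_on (sphere 0 1) g" and nonneg: "\<And>u. u \<in> sphere 0 1 \<Longrightarrow> 0 \<le> g u"
    and int: "(LINT u|sphere_measure. g u) \<le> 0" and u: "u \<in> sphere 0 1"
  shows "g u = 0"
proof (rule ccontr)
  assume "g u \<noteq> 0"
  with nonneg[OF u] have pos: "0 < g u" by simp
  \<comment> \<open>By polar coordinates this open set has measure zero.\<close>
  let ?E = "{x. x \<noteq> 0 \<and> norm x ^ CARD('n) < g (sgn x)}"
  have "continuous_on (UNIV - {0}) (\<lambda>x. g (sgn x))"
    by (rule continuous_on_compose2[OF g]) (auto intro!: continuous_intros simp: norm_sgn split: if_splits)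
  then have "open ((UNIV - {0}) \<inter> (\<lambda>x. g (sgn x) - norm x ^ CARD('n)) -` {0<..})"
    by (intro continuous_open_preimage continuous_intros) auto
  also have "(UNIV - {0}) \<inter> (\<lambda>x. g (sgn x) - norm x ^ CARD('n)) -` {0<..} = ?E" by auto
  finally have "open ?E" .
  moreover have "?E \<in> null_sets lborel"
    using emeasure_radial_sublevel_continuous[OF g nonneg] int by (auto simp: null_sets_def ennreal_neg)
  then have "negligible ?E" by (simp add: negligible_iff_null_sets null_sets_completionI)
  ultimately have empty: "?E = {}" using open_not_negligible by blast
  \<comment> \<open>A height on the ray through \<open>u\<close> that lies in \<open>?E\<close>:
    \<open>s \<le> 1\<close> gives \<open>s ^ n \<le> s\<close>, and \<open>s < g u\<close>.\<close>
  define s where "s = min 1 (g u / 2)"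
  have s: "0 < s" "s \<le> 1" "s < g u" using pos by (auto simp: s_def)
  have "s ^ CARD('n) \<le> s ^ 1"
    using s by (intro power_decreasing) (auto simp: Suc_leI)
  moreover have "u \<noteq> 0" "norm u = 1" "sgn u = u" using u by (auto simp: sgn_div_norm)
  ultimately have "s *\<^sub>R u \<in> ?E" using s by (simp add: sgn_scaleR)
  with empty show False by blast
qed

subsection \<open>Support lines\<close>

text \<open>The slope is the infimum of the difference quotients to the right of \<open>m\<close>,
  that is, the right derivative.\<close>

lemma convex_on_imp_support_line:
  fixes f :: "real \<Rightarrow> real"
  assumes "convex_on S f" and "m \<in> interior S"
  obtains s where "\<And>x. x \<in> S \<Longrightarrow> f m + s * (x - m) \<le> f x"
  using convex_le_Inf_differential[OF assms] by blast

text \<open>If the line touched the graph at \<open>x\<close> as well as at \<open>m\<close>, strict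
  convexity would push the graph below the line at the midpoint \<open>y\<close>.\<close>

lemma strictly_convex_support_line_strict:
  fixes f :: "real \<Rightarrow> real"
  assumes conv: "strictly_convex_on S f" and line: "\<And>x. x \<in> S \<Longrightarrow> f m + s * (x - m) \<le> f x"
    and "m \<in> S" "x \<in> S" "x \<noteq> m"
  shows "f m + s * (x - m) < f x"
proof -
  define y where "y = (1 - 1/2) * m + (1/2) * x"
  have "f y < (1 - 1/2) * f m + (1/2) * f x"
    unfolding y_def
    by (rule conv[unfolded strictly_convex_on_def, THEN conjunct2, rule_format])
      (use assms(3-5) in auto)
  moreover have "y \<in> S"
    using conv assms(3-4) unfolding strictly_convex_on_def y_def
    by (auto dest!: convexD[of S m x "1 - 1/2" "1/2"])
  note line[OF this]
  moreover have "s * (y - m) = s * (x - m) / 2" by (simp add: y_def field_simps)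
  ultimately show ?thesis by simp
qed

subsection \<open>Star bodies and their radial functions\<close>

lemma star_body_radial_pos: "star_body K \<Longrightarrow> norm u = 1 \<Longrightarrow> 0 < radial K u"
  by (simp add: star_body_def)

lemma star_body_continuous_radial: "star_body K \<Longrightarrow> continuous_on (sphere 0 1) (radial K)"
  by (simp add: star_body_def)

text \<open>The admissible factors on a ray form a compact set containing 0, so the
  \<open>GREATEST\<close> in \<open>radial\<close> is attained; star-shapedness fills in everything
  below it.\<close>

lemma star_body_mem_iff:
  assumes K: "star_body K" and u: "norm u = 1" and l: "0 \<le> l"
  shows "l *\<^sub>R u \<in> K \<longleftrightarrow> l \<le> radial K u"
proof -
  have K': "compact K" "0 \<in> K" "\<And>x. x \<in> K \<Longrightarrow> closed_segment 0 x \<subseteq> K"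
    using K by (auto simp: star_body_def)
  let ?T = "{l. 0 \<le> l \<and> l *\<^sub>R u \<in> K}"
  have "closed ((\<lambda>l::real. l *\<^sub>R u) -` K)"
    using K'(1) by (intro closed_vimage compact_imp_closed) (auto intro!: continuous_intros)
  then have "closed ({0..} \<inter> (\<lambda>l. l *\<^sub>R u) -` K)" by (intro closed_Int) auto
  moreover have "{0..} \<inter> (\<lambda>l. l *\<^sub>R u) -` K = ?T" by auto
  moreover obtain B where B: "\<And>x. x \<in> K \<Longrightarrow> norm x \<le> B"
    using compact_imp_bounded[OF K'(1)] by (auto simp: bounded_iff)
  then have "bounded ?T" using u by (intro boundedI[of _ B]) force
  ultimately have "compact ?T" by (simp add: compact_eq_bounded_closed)
  moreover have "0 \<in> ?T" using K' by simp
  ultimately obtain r where r: "r \<in> ?T" "\<And>y. y \<in> ?T \<Longrightarrow> y \<le> r"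
    using compact_attains_sup[of ?T] by blast
  then have rad: "radial K u = r"
    unfolding radial_def by (intro Greatest_equality) auto
  show ?thesis
  proof
    assume "l *\<^sub>R u \<in> K" then show "l \<le> radial K u" using r(2)[of l] l rad by simp
  next
    assume lr: "l \<le> radial K u"
    show "l *\<^sub>R u \<in> K"
    proof (cases "r = 0")
      case True then show ?thesis using lr l rad K'(2) by simp
    next
      case False
      then have "l *\<^sub>R u = (1 - l/r) *\<^sub>R 0 + (l/r) *\<^sub>R (r *\<^sub>R u)" "0 \<le> l/r" "l/r \<le> 1"
        using lr l r(1) rad by auto
      then have "l *\<^sub>R u \<in> closed_segment 0 (r *\<^sub>R u)" unfolding in_segment by blast
      then show ?thesis using K'(3)[of "r *\<^sub>R u"] r(1) by blast
    qed
  qed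
qed

text \<open>Polar description of the body. The origin is listed apart because
  \<open>sgn 0 = 0\<close> is not a unit vector.\<close>

lemma star_body_eq:
  assumes "star_body K"
  shows "K = {x. x = 0 \<or> norm x \<le> radial K (sgn x)}"
proof (rule set_eqI)
  fix x
  show "x \<in> K \<longleftrightarrow> x \<in> {x. x = 0 \<or> norm x \<le> radial K (sgn x)}"
  proof (cases "x = 0")
    case True then show ?thesis using assms by (simp add: star_body_def)
  next
    case False
    then show ?thesis
      using star_body_mem_iff[OF assms norm_sgn_nonzero, of x "norm x"] by (simp add: norm_scaleR_sgn)
  qed
qed

text \<open>\<open>l\<close> is admissible for \<open>L\<close> in direction \<open>u\<close>
  exactly if \<open>l / c\<close> is admissible for \<open>K\<close>, so the maxima differ by the
  factor \<open>c\<close>.\<close>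

lemma dilates_imp_radial:
  assumes K: "star_body K" and L: "star_body L" and c: "0 < c" and eq: "L = (\<lambda>x. c *\<^sub>R x) ` K"
    and u: "norm u = 1"
  shows "radial L u = c * radial K u"
proof -
  have mem: "l *\<^sub>R u \<in> L \<longleftrightarrow> (l / c) *\<^sub>R u \<in> K" for l
  proof
    assume "l *\<^sub>R u \<in> L"
    then obtain x where "x \<in> K" "l *\<^sub>R u = c *\<^sub>R x" unfolding eq by blast
    moreover from this have "(l / c) *\<^sub>R u = x"
      using c by (metis divide_inverse mult.commute scaleR_scaleR scaleR_one left_inverse less_irrefl)
    ultimately show "(l / c) *\<^sub>R u \<in> K" by simp
  next
    assume "(l / c) *\<^sub>R u \<in> K"
    then have "c *\<^sub>R ((l / c) *\<^sub>R u) \<in> L" unfolding eq by blast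
    then show "l *\<^sub>R u \<in> L" using c by simp
  qed
  have "l \<le> radial L u \<longleftrightarrow> l \<le> c * radial K u" if "0 \<le> l" for l
    using star_body_mem_iff[OF L u that] star_body_mem_iff[OF K u, of "l / c"] that c mem[of l]
    by (simp add: divide_le_eq mult.commute)
  from this[of "radial L u"] this[of "c * radial K u"] show ?thesis
    using star_body_radial_pos[OF K u] star_body_radial_pos[OF L u] c by auto
qed

text \<open>Dilation by \<open>c > 0\<close> preserves \<open>sgn\<close> and multiplies the norm by
  \<open>c\<close>, so it matches the polar descriptions of \<open>K\<close> and
  \<open>L\<close>.\<close>

lemma dilates_if_radial:
  assumes K: "star_body K" and L: "star_body L" and c: "0 < c"
    and eq: "\<And>u. norm u = 1 \<Longrightarrow> radial L u = c * radial K u"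
  shows "dilates K L"
proof -
  have mem: "c *\<^sub>R x \<in> L \<longleftrightarrow> x \<in> K" for x
  proof (cases "x = 0")
    case False
    then show ?thesis
      using c by (subst star_body_eq[OF K], subst star_body_eq[OF L])
        (simp add: eq norm_sgn_nonzero sgn_scaleR)
  qed (use K L in \<open>simp add: star_body_def\<close>)
  have "L = (\<lambda>x. c *\<^sub>R x) ` K"
  proof (intro equalityI subsetI)
    fix x assume "x \<in> L"
    then have "(1/c) *\<^sub>R x \<in> K" "x = c *\<^sub>R ((1/c) *\<^sub>R x)"
      using c by (simp_all flip: mem)
    then show "x \<in> (\<lambda>x. c *\<^sub>R x) ` K" by blast
  qed (auto simp: mem)
  with c show ?thesis by (auto simp: dilates_def)
qed

section \<open>Volume in terms of the radial function\<close>

text \<open>Up to the origin, \<open>K\<close> lies between the regions \<open>?E 1\<close> and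
  \<open>?E c\<close> for every \<open>c > 1\<close>, and \<open>n\<close> times the volume of
  \<open>?E c\<close> is \<open>c * I\<close>. Letting \<open>c\<close> tend to 1 closes the
  gap.\<close>

lemma volume_eq_integral_radial:
  fixes K :: "(real^'n) set"
  assumes K: "star_body K"
  shows "CARD('n) * vol K = (LINT u|sphere_measure. radial K u ^ CARD('n))"
proof -
  let ?n = "CARD('n)"
  define I where "I = (LINT u|sphere_measure. radial K u ^ ?n)"
  have pos: "0 < radial K (sgn x)" if "x \<noteq> 0" for x
    using star_body_radial_pos[OF K] that by (simp add: norm_sgn_nonzero)
  have "compact K" using K by (simp add: star_body_def)
  then have fin: "emeasure lborel K = ennreal (vol K)" and Km: "K \<in> sets lborel"
    using emeasure_compact_finite[of K] by (auto intro!: emeasure_eq_ennreal_measure borel_compact)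
  have I: "0 \<le> I"
    unfolding I_def
    by (rule Bochner_Integration.integral_nonneg)
      (use star_body_radial_pos[OF K] in \<open>auto simp: space_sphere_measure less_imp_le\<close>)
  let ?E = "\<lambda>c. {x. x \<noteq> 0 \<and> norm x ^ ?n < c * radial K (sgn x) ^ ?n}"
  have E: "?E c \<in> sets lborel" "of_nat ?n * emeasure lborel (?E c) = ennreal (c * I)"
    if "0 \<le> c" for c
  proof -
    have *: "continuous_on (sphere 0 1) (\<lambda>u. c * radial K u ^ ?n)"
      by (intro continuous_intros star_body_continuous_radial K)
    have **: "0 \<le> c * radial K u ^ ?n" if "u \<in> sphere 0 1" for u
      using star_body_radial_pos[OF K, of u] that \<open>0 \<le> c\<close> by simp
    show "?E c \<in> sets lborel" "of_nat ?n * emeasure lborel (?E c) = ennreal (c * I)"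
      using emeasure_radial_sublevel_continuous[OF * **] by (simp_all add: I_def)
  qed
  have "?E 1 \<subseteq> K"
  proof
    fix x assume x: "x \<in> ?E 1"
    then have "norm x < radial K (sgn x)"
      using pos[of x] by (auto intro: power_less_imp_less_base)
    then show "x \<in> K" by (subst star_body_eq[OF K]) simp
  qed
  then have "of_nat ?n * emeasure lborel (?E 1) \<le> of_nat ?n * emeasure lborel K"
    by (intro mult_left_mono emeasure_mono Km) auto
  then have "ennreal I \<le> ennreal (?n * vol K)"
    using E(2)[of 1] by (simp add: fin ennreal_mult' ennreal_of_nat_eq_real_of_nat)
  then have lower: "I \<le> ?n * vol K" using I by (simp add: ennreal_le_iff)
  \<comment> \<open>The region \<open>?E 1\<close> omits the boundary of \<open>K\<close>; inflating it slightly covers the boundary too.\<close>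
  have upper: "?n * vol K \<le> c * I" if c: "1 < c" for c
  proof -
    have sub: "K - {0} \<subseteq> ?E c"
    proof
      fix x assume x: "x \<in> K - {0}"
      then have "norm x \<le> radial K (sgn x)" by (subst (asm) star_body_eq[OF K]) auto
      then have "norm x ^ ?n \<le> radial K (sgn x) ^ ?n" by (intro power_mono) auto
      also have "\<dots> < c * radial K (sgn x) ^ ?n" using c pos[of x] x by simp
      finally show "x \<in> ?E c" using x by simp
    qed
    have "emeasure lborel K = emeasure lborel (K - {0})"
      using Km by (intro emeasure_Diff_null_set[symmetric]) auto
    also have "\<dots> \<le> emeasure lborel (?E c)" using E(1)[of c] c sub by (intro emeasure_mono) auto
    finally have "of_nat ?n * emeasure lborel K \<le> of_nat ?n * emeasure lborel (?E c)"
      by (intro mult_left_mono) auto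
    then have "ennreal (?n * vol K) \<le> ennreal (c * I)"
      using E(2)[of c] c by (simp add: fin ennreal_mult' ennreal_of_nat_eq_real_of_nat)
    then show ?thesis using I c by (simp add: ennreal_le_iff)
  qed
  have "?n * vol K \<le> I"
  proof (rule LIMSEQ_le_const)
    show "(\<lambda>k. (1 + 1 / real (Suc k)) * I) \<longlonglongrightarrow> I"
      using tendsto_mult[OF tendsto_add[OF tendsto_const LIMSEQ_inverse_real_of_nat] tendsto_const, of 1 I]
      by (simp add: inverse_eq_divide)
  qed (use upper in auto)
  with lower show ?thesis by (simp add: I_def)
qed

text \<open>The radial function attains a positive minimum on the compact sphere, and
  \<open>K\<close> contains the ball of that radius.\<close>

lemma star_body_volume_pos:
  fixes K :: "(real^'n) set"
  assumes K: "star_body K"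
  shows "0 < vol K"
proof -
  have "compact (sphere (0::real^'n) 1)" "sphere (0::real^'n) 1 \<noteq> {}" by auto
  then obtain v where v: "v \<in> sphere 0 1" "\<And>u. u \<in> sphere 0 1 \<Longrightarrow> radial K v \<le> radial K u"
    using continuous_attains_inf[OF _ _ star_body_continuous_radial[OF K]] by blast
  have pos: "0 < radial K v" using v(1) star_body_radial_pos[OF K] by simp
  have sub: "ball (0::real^'n) (radial K v) \<subseteq> K"
  proof
    fix x :: "real^'n" assume "x \<in> ball 0 (radial K v)"
    then show "x \<in> K"
      using v(2)[of "sgn x"] norm_sgn_nonzero[of x] by (subst star_body_eq[OF K]) fastforce
  qed
  have "compact K" using K by (simp add: star_body_def)
  then have "K \<in> fmeasurable lborel"
    using emeasure_compact_finite[of K] by (auto intro!: fmeasurableI borel_compact)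
  then have "measure lborel (ball (0::real^'n) (radial K v)) \<le> vol K"
    by (intro measure_mono_fmeasurable[OF sub]) auto
  moreover have "0 < measure lborel (ball (0::real^'n) (radial K v))"
    by (rule content_ball_pos[OF pos])
  ultimately show ?thesis by linarith
qed

subsection \<open>The Orlicz modular of a pair of star bodies\<close>

locale Orlicz_pair =
  fixes \<phi> :: "real \<Rightarrow> real" and K L :: "(real^'n) set" and a :: real
  assumes Phi: "\<phi> \<in> \<Phi>" and K: "star_body K" and L: "star_body L" and a: "0 < a"
begin

definition ratio :: "real \<Rightarrow> real^'n \<Rightarrow> real" where
  "ratio l u = a * radial L u ^ CARD('n) / (l ^ CARD('n) * radial K u ^ CARD('n))"

text \<open>The modular of Orlicz space theory for the density \<open>radial K u ^ n\<close>, which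
  is left unnormalised: its total mass is \<open>n\<close> times \<open>vol K\<close>.\<close>

definition modular :: "real \<Rightarrow> real" where
  "modular l = (LINT u|sphere_measure. \<phi> (ratio l u) * radial K u ^ CARD('n))"

text \<open>The set under the infimum in \<open>Orlicz_dual\<close> for \<open>a = k2 / k1\<close>,
  with the denominator cleared.\<close>

definition feasible :: "real set" where
  "feasible = {l. 0 < l \<and> modular l \<le> CARD('n) * vol K}"

lemma phi_convex: "convex_on {0..} \<phi>" and phi_0: "\<phi> 0 = 0" and phi_1: "\<phi> 1 = 1"
  using Phi by (auto simp: Orlicz_functions_def)

lemma phi_less_iff: "0 \<le> x \<Longrightarrow> 0 \<le> y \<Longrightarrow> \<phi> x < \<phi> y \<longleftrightarrow> x < y"
  using Phi by (auto simp: Orlicz_functions_def strict_mono_on_less)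

lemma phi_le_iff: "0 \<le> x \<Longrightarrow> 0 \<le> y \<Longrightarrow> \<phi> x \<le> \<phi> y \<longleftrightarrow> x \<le> y"
  using phi_less_iff[of y x] by (simp flip: not_less)

text \<open>Convexity gives continuity on the open half-line; this suffices because every
  \<open>ratio\<close> with \<open>0 < l\<close> is positive on the sphere.\<close>

lemma phi_continuous: "continuous_on {0<..} \<phi>"
  by (intro convex_on_continuous convex_on_subset[OF phi_convex]) auto

lemma ratio_pos: "0 < l \<Longrightarrow> norm u = 1 \<Longrightarrow> 0 < ratio l u"
  using a star_body_radial_pos[OF K, of u] star_body_radial_pos[OF L, of u]
  by (simp add: ratio_def)

lemma ratio_continuous: "0 < l \<Longrightarrow> continuous_on (sphere 0 1) (ratio l)"
  unfolding ratio_def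
  by (intro continuous_intros star_body_continuous_radial K L)
    (use star_body_radial_pos[OF K] in fastforce)

lemma phi_ratio_continuous: "0 < l \<Longrightarrow> continuous_on (sphere 0 1) (\<lambda>u. \<phi> (ratio l u))"
  by (rule continuous_on_compose2[OF phi_continuous ratio_continuous]) (auto simp: ratio_pos)

lemma modular_integrable:
  "0 < l \<Longrightarrow> integrable sphere_measure (\<lambda>u. \<phi> (ratio l u) * radial K u ^ CARD('n))"
  by (intro integrable_sphere_continuous continuous_intros phi_ratio_continuous
      star_body_continuous_radial K)

lemma ratio_antimono:
  assumes "0 < l" "l \<le> l'" "norm u = 1"
  shows "ratio l' u \<le> ratio l u"
  unfolding ratio_def
  using assms a star_body_radial_pos[OF K, of u] star_body_radial_pos[OF L, of u]
  by (intro divide_left_mono mult_right_mono power_mono mult_nonneg_nonneg mult_pos_pos) auto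

lemma modular_antimono:
  assumes "0 < l" "l \<le> l'"
  shows "modular l' \<le> modular l"
  unfolding modular_def
proof (rule integral_mono)
  fix u :: "real^'n" assume "u \<in> space sphere_measure"
  then have u: "norm u = 1" by (simp add: space_sphere_measure)
  show "\<phi> (ratio l' u) * radial K u ^ CARD('n) \<le> \<phi> (ratio l u) * radial K u ^ CARD('n)"
    using ratio_antimono[OF assms u] ratio_pos[of l u] ratio_pos[of l' u] assms u
      star_body_radial_pos[OF K u]
    by (intro mult_right_mono) (auto simp: phi_le_iff)
qed (use assms in \<open>auto intro!: modular_integrable\<close>)

text \<open>The defect in Jensen's inequality, measured against the line of slope \<open>s\<close>
  through \<open>(m, b)\<close>. The weight cancels the denominator of \<open>ratio\<close>, which
  leaves the volume of \<open>L\<close>; the slope term vanishes if \<open>m\<close> is the weighted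
  mean of \<open>ratio l\<close>.\<close>

lemma integral_ratio_defect:
  assumes l: "0 < l"
  shows "(LINT u|sphere_measure. (\<phi> (ratio l u) - b - s * (ratio l u - m)) * radial K u ^ CARD('n))
    = modular l - b * (CARD('n) * vol K) - s * (a / l ^ CARD('n) * (CARD('n) * vol L) - m * (CARD('n) * vol K))"
proof -
  have "(LINT u|sphere_measure. (\<phi> (ratio l u) - b - s * (ratio l u - m)) * radial K u ^ CARD('n))
    = (LINT u|sphere_measure. \<phi> (ratio l u) * radial K u ^ CARD('n) - b * radial K u ^ CARD('n)
        - s * (a / l ^ CARD('n) * radial L u ^ CARD('n) - m * radial K u ^ CARD('n)))"
  proof (rule Bochner_Integration.integral_cong[OF refl])
    fix u :: "real^'n" assume "u \<in> space sphere_measure"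
    then have "radial K u > 0" using star_body_radial_pos[OF K] by (simp add: space_sphere_measure)
    then have "ratio l u * radial K u ^ CARD('n) = a / l ^ CARD('n) * radial L u ^ CARD('n)"
      using l by (simp add: ratio_def)
    then show "(\<phi> (ratio l u) - b - s * (ratio l u - m)) * radial K u ^ CARD('n)
      = \<phi> (ratio l u) * radial K u ^ CARD('n) - b * radial K u ^ CARD('n)
        - s * (a / l ^ CARD('n) * radial L u ^ CARD('n) - m * radial K u ^ CARD('n))"
      by (simp only: left_diff_distrib right_diff_distrib mult.assoc)
  qed
  moreover have "integrable sphere_measure (\<lambda>u. radial M u ^ CARD('n))" if "star_body M" for M :: "(real^'n) set"
    by (intro integrable_sphere_continuous continuous_intros star_body_continuous_radial that)
  ultimately show ?thesis
    using modular_integrable[OF l] K L by (simp add: modular_def volume_eq_integral_radial)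
qed

lemma ratio_scale: "0 < l \<Longrightarrow> ratio l u = ratio 1 u / l ^ CARD('n)"
  by (simp add: ratio_def)

lemma ratio_eq_1_imp_modular:
  assumes "\<And>u. norm u = 1 \<Longrightarrow> ratio l u = 1"
  shows "modular l = CARD('n) * vol K"
  unfolding modular_def volume_eq_integral_radial[OF K]
  by (rule Bochner_Integration.integral_cong) (auto simp: space_sphere_measure assms phi_1)

section \<open>The lower bound\<close>

text \<open>For large \<open>l\<close> the ratio is at most 1 in every direction, and then
  \<open>\<phi>\<close> of it is at most \<open>\<phi> 1 = 1\<close>.\<close>

lemma feasible_nonempty: "feasible \<noteq> {}"
proof -
  have "bounded (ratio 1 ` sphere 0 1)"
    by (intro compact_imp_bounded compact_continuous_image ratio_continuous) auto
  then obtain B where B: "\<And>u. u \<in> sphere 0 1 \<Longrightarrow> norm (ratio 1 u) \<le> B"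
    unfolding bounded_iff by blast
  \<comment> \<open>\<open>1 \<le> l\<close> gives \<open>l \<le> l ^ n\<close>, so
    \<open>B \<le> l\<close> suffices for \<open>ratio 1 u \<le> l ^ n\<close>.\<close>
  define l where "l = max 1 B"
  have l: "1 \<le> l" "B \<le> l" "0 < l" by (auto simp: l_def)
  have "modular l \<le> (LINT u|sphere_measure. radial K u ^ CARD('n))"
    unfolding modular_def
  proof (rule integral_mono)
    fix u :: "real^'n" assume "u \<in> space sphere_measure"
    then have u: "norm u = 1" by (simp add: space_sphere_measure)
    have "l ^ 1 \<le> l ^ CARD('n)" using l by (intro power_increasing) (auto simp: Suc_leI)
    then have "ratio l u \<le> 1"
      using B[of u] u l by (simp add: ratio_scale[of l])
    then have "\<phi> (ratio l u) \<le> 1"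
      using phi_le_iff[of "ratio l u" 1] ratio_pos[OF l(3) u] by (simp add: phi_1)
    then show "\<phi> (ratio l u) * radial K u ^ CARD('n) \<le> radial K u ^ CARD('n)"
      using star_body_radial_pos[OF K u] by simp
  qed (use l in \<open>auto intro!: integrable_sphere_continuous continuous_intros
        phi_ratio_continuous star_body_continuous_radial K\<close>)
  then have "l \<in> feasible" using l by (simp add: feasible_def volume_eq_integral_radial[OF K])
  then show ?thesis by blast
qed

lemma feasible_lower_bound:
  assumes "l \<in> feasible"
  shows "(a * (vol L / vol K)) powr (1 / CARD('n)) \<le> l"
proof -
  have l: "0 < l" "modular l \<le> CARD('n) * vol K" using assms by (auto simp: feasible_def)
  note V = star_body_volume_pos[OF K] star_body_volume_pos[OF L]
  \<comment> \<open>The mean of \<open>ratio l\<close> with respect to the normalised weight, which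
    makes the slope term of \<open>integral_ratio_defect\<close> vanish.\<close>
  define m where "m = a * vol L / (l ^ CARD('n) * vol K)"
  have m: "0 < m" using a V l by (simp add: m_def)
  obtain s where s: "\<And>x. x \<in> {0..} \<Longrightarrow> \<phi> m + s * (x - m) \<le> \<phi> x"
    using convex_on_imp_support_line[OF phi_convex, of m] m by auto
  have "0 \<le> (LINT u|sphere_measure. (\<phi> (ratio l u) - \<phi> m - s * (ratio l u - m)) * radial K u ^ CARD('n))"
  proof (rule Bochner_Integration.integral_nonneg)
    fix u :: "real^'n" assume "u \<in> space sphere_measure"
    then have u: "norm u = 1" by (simp add: space_sphere_measure)
    then show "0 \<le> (\<phi> (ratio l u) - \<phi> m - s * (ratio l u - m)) * radial K u ^ CARD('n)"
      using s[of "ratio l u"] ratio_pos[OF l(1) u] star_body_radial_pos[OF K u] by simp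
  qed
  moreover have "a / l ^ CARD('n) * (CARD('n) * vol L) - m * (CARD('n) * vol K) = 0"
    using V by (simp add: m_def)
  ultimately have "\<phi> m * (CARD('n) * vol K) \<le> modular l"
    using integral_ratio_defect[OF l(1), of "\<phi> m" s m] by simp
  also note l(2)
  finally have "\<phi> m \<le> \<phi> 1" using V by (simp add: phi_1)
  then have "m \<le> 1" using m by (simp add: phi_le_iff)
  then have "a * (vol L / vol K) \<le> l ^ CARD('n)"
    using V l by (simp add: m_def divide_le_eq)
  then have "(a * (vol L / vol K)) powr (1 / CARD('n)) \<le> (l ^ CARD('n)) powr (1 / CARD('n))"
    using a V by (intro powr_mono2) auto
  also have "\<dots> = l" using l by (simp add: powr_realpow[symmetric] powr_powr)
  finally show ?thesis .
qed

lemma Inf_feasible_lower_bound: "(a * (vol L / vol K)) powr (1 / CARD('n)) \<le> Inf feasible"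
  by (rule cInf_greatest[OF feasible_nonempty feasible_lower_bound])

section \<open>The equality case\<close>

text \<open>If \<open>L\<close> is \<open>c\<close> times \<open>K\<close>, then
  \<open>ratio l\<close> is the constant \<open>a * c ^ n / l ^ n\<close>, which is 1 at
  \<open>l = ?R\<close>. Hence the lower bound is itself feasible.\<close>

lemma dilates_imp_eq:
  assumes "dilates K L"
  shows "Inf feasible = (a * (vol L / vol K)) powr (1 / CARD('n))" (is "_ = ?R")
proof -
  note V = star_body_volume_pos[OF K] star_body_volume_pos[OF L]
  obtain c where c: "0 < c" "L = (\<lambda>x. c *\<^sub>R x) ` K" using assms by (auto simp: dilates_def)
  have rad: "radial L u = c * radial K u" if "norm u = 1" for u
    by (rule dilates_imp_radial[OF K L c that])
  have "CARD('n) * vol L = (LINT u|sphere_measure. c ^ CARD('n) * radial K u ^ CARD('n))"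
    unfolding volume_eq_integral_radial[OF L]
    by (rule Bochner_Integration.integral_cong)
      (auto simp: space_sphere_measure rad power_mult_distrib)
  then have "CARD('n) * vol L = c ^ CARD('n) * (CARD('n) * vol K)"
    by (simp add: volume_eq_integral_radial[OF K])
  then have "a * (vol L / vol K) = a * c ^ CARD('n)" using V by (simp add: field_simps)
  then have R: "?R ^ CARD('n) = a * c ^ CARD('n)" "0 < ?R"
    using a c by (simp_all add: powr_realpow[symmetric] powr_powr)
  have "ratio ?R u = 1" if "norm u = 1" for u
    unfolding ratio_def R(1) using star_body_radial_pos[OF K that] a c(1)
    by (simp add: rad[OF that] power_mult_distrib)
  then have "?R \<in> feasible" using R by (simp add: feasible_def ratio_eq_1_imp_modular)
  then have "Inf feasible \<le> ?R"
    by (rule cInf_lower) (auto intro!: bdd_belowI[of _ 0] simp: feasible_def)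
  with Inf_feasible_lower_bound show ?thesis by simp
qed

text \<open>The infimum is approached from above, where the constraint holds by monotonicity, and
  the constraint passes to the limit by dominated convergence.\<close>

lemma Inf_feasible_mem:
  assumes pos: "0 < Inf feasible"
  shows "Inf feasible \<in> feasible"
proof -
  define R where "R = Inf feasible"
  have R: "0 < R" using pos by (simp add: R_def)
  define l where "l k = R * (1 + 1 / real (Suc k))" for k
  have l: "R < l k" "0 < l k" for k using R by (auto simp: l_def intro!: mult_pos_pos add_pos_pos)
  have le: "modular (l k) \<le> CARD('n) * vol K" for k
  proof -
    \<comment> \<open>As \<open>l k\<close> exceeds the infimum, some feasible \<open>l'\<close>
      lies below it, and \<open>modular\<close> is antitone.\<close>
    obtain l' where l': "l' \<in> feasible" "l' < l k"
      using l(1)[of k] feasible_nonempty cInf_lessD unfolding R_def by metis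
    then show ?thesis
      using modular_antimono[of l' "l k"] by (simp add: feasible_def)
  qed
  have lim: "l \<longlonglongrightarrow> R"
    unfolding l_def
    using tendsto_mult[OF tendsto_const tendsto_add[OF tendsto_const LIMSEQ_inverse_real_of_nat], of R 1]
    by (simp add: inverse_eq_divide)
  \<comment> \<open>Since \<open>R < l k\<close> and \<open>ratio\<close> decreases in
    \<open>l\<close>, the integrand at the limit \<open>R\<close> dominates all the others.\<close>
  have "(\<lambda>k. modular (l k)) \<longlonglongrightarrow> modular R"
    unfolding modular_def
  proof (rule integral_dominated_convergence[where w = "\<lambda>u. \<phi> (ratio R u) * radial K u ^ CARD('n)"])
    show "AE u in sphere_measure. (\<lambda>k. \<phi> (ratio (l k) u) * radial K u ^ CARD('n))
        \<longlonglongrightarrow> \<phi> (ratio R u) * radial K u ^ CARD('n)"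
    proof (rule AE_I2)
      fix u :: "real^'n" assume "u \<in> space sphere_measure"
      then have u: "norm u = 1" by (simp add: space_sphere_measure)
      have "(\<lambda>k. ratio (l k) u) \<longlonglongrightarrow> ratio R u"
        unfolding ratio_def using lim R star_body_radial_pos[OF K u]
        by (intro tendsto_intros) auto
      then have "(\<lambda>k. \<phi> (ratio (l k) u)) \<longlonglongrightarrow> \<phi> (ratio R u)"
        using ratio_pos[OF R u] ratio_pos[OF l(2) u]
        by (intro continuous_on_tendsto_compose[OF phi_continuous]) auto
      then show "(\<lambda>k. \<phi> (ratio (l k) u) * radial K u ^ CARD('n)) \<longlonglongrightarrow> \<phi> (ratio R u) * radial K u ^ CARD('n)"
        by (intro tendsto_intros)
    qed
    show "AE u in sphere_measure. norm (\<phi> (ratio (l k) u) * radial K u ^ CARD('n)) \<le> \<phi> (ratio R u) * radial K u ^ CARD('n)" for k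
    proof (rule AE_I2)
      fix u :: "real^'n" assume "u \<in> space sphere_measure"
      then have u: "norm u = 1" by (simp add: space_sphere_measure)
      have "0 \<le> \<phi> (ratio (l k) u)"
        using phi_le_iff[of 0 "ratio (l k) u"] ratio_pos[OF l(2) u, of k] by (simp add: phi_0)
      moreover have "\<phi> (ratio (l k) u) \<le> \<phi> (ratio R u)"
        using ratio_antimono[OF R _ u, of "l k"] l(1)[of k] ratio_pos[OF l(2) u, of k] ratio_pos[OF R u]
        by (simp add: phi_le_iff)
      ultimately show "norm (\<phi> (ratio (l k) u) * radial K u ^ CARD('n)) \<le> \<phi> (ratio R u) * radial K u ^ CARD('n)"
        using star_body_radial_pos[OF K u] by (simp add: abs_mult)
    qed
  qed (use l R in \<open>auto intro!: modular_integrable borel_measurable_integrable\<close>)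
  then have "modular R \<le> CARD('n) * vol K"
    by (rule LIMSEQ_le_const2) (use le in auto)
  with R show ?thesis by (simp add: feasible_def R_def)
qed

text \<open>At the infimum the Jensen defect is continuous, nonnegative and of integral at most 0,
  so it vanishes in every direction; by strict convexity this happens only where the ratio is
  1.\<close>

lemma eq_imp_dilates:
  assumes strict: "strictly_convex_on {0..} \<phi>"
    and eq: "Inf feasible = (a * (vol L / vol K)) powr (1 / CARD('n))"
  shows "dilates K L"
proof -
  note V = star_body_volume_pos[OF K] star_body_volume_pos[OF L]
  define R where "R = Inf feasible"
  have R: "0 < R" "R ^ CARD('n) = a * (vol L / vol K)"
    unfolding R_def eq using a V by (simp_all add: powr_realpow[symmetric] powr_powr)
  obtain s where s: "\<And>x. x \<in> {0..} \<Longrightarrow> \<phi> 1 + s * (x - 1) \<le> \<phi> x"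
    using convex_on_imp_support_line[OF phi_convex, of 1] by auto
  have "modular R \<le> CARD('n) * vol K"
    using Inf_feasible_mem R by (simp add: R_def feasible_def)
  \<comment> \<open>By the value of \<open>R ^ n\<close>, the weighted mean of
    \<open>ratio R\<close> is 1, the point where the support line was taken.\<close>
  moreover have "a / R ^ CARD('n) * (CARD('n) * vol L) - 1 * (CARD('n) * vol K) = 0"
    using V a by (simp add: R(2))
  ultimately have int:
    "(LINT u|sphere_measure. (\<phi> (ratio R u) - \<phi> 1 - s * (ratio R u - 1)) * radial K u ^ CARD('n)) \<le> 0"
    unfolding integral_ratio_defect[OF R(1)] by (simp add: phi_1)
  have ratio1: "ratio R u = 1" if u: "norm u = 1" for u
  proof (rule ccontr)
    assume "ratio R u \<noteq> 1"
    then have "\<phi> 1 + s * (ratio R u - 1) < \<phi> (ratio R u)"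
      using strictly_convex_support_line_strict[OF strict s, of "ratio R u"] ratio_pos[OF R(1) u] by simp
    moreover have "(\<phi> (ratio R u) - \<phi> 1 - s * (ratio R u - 1)) * radial K u ^ CARD('n) = 0"
    proof (rule sphere_integral_0_imp[OF _ _ int])
      show "continuous_on (sphere 0 1)
        (\<lambda>u. (\<phi> (ratio R u) - \<phi> 1 - s * (ratio R u - 1)) * radial K u ^ CARD('n))"
        by (intro continuous_intros phi_ratio_continuous ratio_continuous star_body_continuous_radial K R)
      show "0 \<le> (\<phi> (ratio R v) - \<phi> 1 - s * (ratio R v - 1)) * radial K v ^ CARD('n)" if "v \<in> sphere 0 1" for v
        using s[of "ratio R v"] ratio_pos[OF R(1), of v] star_body_radial_pos[OF K, of v] that by simp
    qed (use u in simp)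
    ultimately show False using star_body_radial_pos[OF K u] by simp
  qed
  \<comment> \<open>The dilation factor read off from \<open>ratio R u = 1\<close>, that is, from
    \<open>a * radial L u ^ n = R ^ n * radial K u ^ n\<close>.\<close>
  define c where "c = R / root CARD('n) a"
  have c: "0 < c" "a * c ^ CARD('n) = R ^ CARD('n)" using R(1) a by (auto simp: c_def power_divide)
  show ?thesis
  proof (rule dilates_if_radial[OF K L c(1)])
    fix u :: "real^'n" assume u: "norm u = 1"
    note pos = star_body_radial_pos[OF K u] star_body_radial_pos[OF L u]
    have "a * radial L u ^ CARD('n) = R ^ CARD('n) * radial K u ^ CARD('n)"
      using ratio1[OF u] pos R(1) by (simp add: ratio_def)
    also have "\<dots> = a * (c * radial K u) ^ CARD('n)" using c(2) by (simp add: power_mult_distrib)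
    finally have "radial L u ^ CARD('n) = (c * radial K u) ^ CARD('n)" using a by simp
    moreover have "0 \<le> radial L u" "0 \<le> c * radial K u" using pos c(1) by auto
    ultimately show "radial L u = c * radial K u" by (rule power_eq_imp_eq_base) simp
  qed
qed

end

theorem theorem7p2:
  fixes K L :: "(real ^ 'n) set" and \<phi> :: "real \<Rightarrow> real" and k1 k2 :: real
  assumes "\<phi> \<in> \<Phi>" and "star_body K" and "star_body L" and "0 < k1" and "0 < k2"
  shows "Orlicz_dual k1 k2 \<phi> K L \<ge> (k2 / k1 * (vol L / vol K)) powr (1 / real CARD('n)) \<and>
    (strictly_convex_on {0..} \<phi> \<and> vol L > 0 \<longrightarrow>
      (Orlicz_dual k1 k2 \<phi> K L = (k2 / k1 * (vol L / vol K)) powr (1 / real CARD('n))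
        \<longleftrightarrow> dilates K L))"
proof -
  interpret Orlicz_pair \<phi> K L "k2 / k1"
    using assms by unfold_locales auto
  have "Orlicz_dual k1 k2 \<phi> K L = Inf feasible"
  proof -
    have "k2 * radial L u ^ CARD('n) / (k1 * l ^ CARD('n) * radial K u ^ CARD('n)) = ratio l u" for l u
      by (simp add: ratio_def)
    \<comment> \<open>Clearing the denominator is an equivalence because \<open>vol K\<close> is
      positive.\<close>
    moreover have "1 / (real CARD('n) * vol K) * x \<le> 1 \<longleftrightarrow> x \<le> CARD('n) * vol K" for x
      using star_body_volume_pos[OF K] by (simp add: divide_le_eq)
    ultimately show ?thesis
      by (simp only: Orlicz_dual_def feasible_def modular_def)
  qed
  then show ?thesis
    using Inf_feasible_lower_bound dilates_imp_eq eq_imp_dilates by metis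
qed

end
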